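(* Let $r\ge3$ be an integer and let $k_1<\cdots<k_r$ be elements of $\mathcal{C}^{o}_{>1}$. If $\pi(k_i)\ge i+2$ for all $i\in\{1,\dots,r\}$, then $2\,\mathbb{Z}^{o}_{\ge3}=2\,(\mathbb{Z}^{o}_{\ge3}\setminus\{k_1,\dots,k_r\})$, and $\{k_1,\dots,k_r\}$ is a 2-th sum-factor collapsed subset of $\mathbb{Z}^{o}_{\ge3}$.
   Context: $\mathbb{Z}^{o}_{\ge3}$ is the set of all odd integers $\ge3$; $\mathcal{C}^{o}_{>1}$ is the set of all odd composite positive integers ($9,15,21,25,\dots$); $\pi(x)$ is the number of primes $\le x$. For a non-empty set $S$ of integers, $2S=\{s+s': s,s'\in S\}$ (the sumset, not the dilation). A subset $C\subset B$ (with $B$ a non-empty set of integers) is a 2-th sum-factor collapsed subset of $B$ if $B\setminus C$ is non-empty, $2B=2(B\setminus C)$, and every $b\in B$ is a product $c_1\cdots c_k$ with $k\ge1$ and all $c_j\in B\setminus C$. *)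

theory Defs
  imports "HOL-Library.Set_Algebras" "HOL-Computational_Algebra.Primes"
begin

text \<open>
  The sumset \<open>2S\<close> is \<open>S + S\<close>, with the pointwise addition of
  \<open>HOL-Library.Set_Algebras\<close>.
\<close>

definition odd_ge3 :: "int set" where
  "odd_ge3 = {n. odd n \<and> n \<ge> 3}"

definition odd_composites :: "int set" where
  "odd_composites = {n. odd n \<and> n > 1 \<and> \<not> prime n}"

text \<open>On \<open>int\<close>, \<open>prime\<close> implies positivity, so the set below is finite.\<close>

definition prime_pi :: "int \<Rightarrow> nat" where
  "prime_pi x = card {p :: int. prime p \<and> p \<le> x}"

text \<open>
  Products \<open>c\<^sub>1 \<cdots> c\<^sub>k\<close> with \<open>k \<ge> 1\<close> are products of
  non-empty lists, so repeated factors are allowed.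
\<close>

definition sum_factor_collapsed_2 :: "int set \<Rightarrow> int set \<Rightarrow> bool" where
  "sum_factor_collapsed_2 C B \<longleftrightarrow>
     B \<noteq> {} \<and> C \<subseteq> B \<and> B - C \<noteq> {} \<and>
     B + B = (B - C) + (B - C) \<and>
     (\<forall>b\<in>B. \<exists>cs. cs \<noteq> [] \<and> set cs \<subseteq> B - C \<and> b = prod_list cs)"

end

theory Submission
  imports Defs
begin

text \<open>
  For even \<open>n \<ge> 6\<close> let \<open>i\<close> be the largest index with \<open>k\<^sub>i \<le> n - 3\<close>
  (if there is none, \<open>n = 3 + (n - 3)\<close> will do).  There are at least \<open>i + 1\<close> odd
  primes \<open>p \<le> k\<^sub>i\<close>, and the \<open>n - p\<close> are distinct odd numbers with \<open>3 \<le> n - p \<le> n - 3\<close>.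
  At most \<open>i\<close> of them are removed, so some \<open>n = p + (n - p)\<close> survives.  The factorization
  condition holds because no prime is removed.
\<close>

lemma odd_prime_in_odd_ge3:
  fixes p :: int
  assumes "prime p" "odd p"
  shows "p \<in> odd_ge3"
  using assms prime_ge_2_int[of p] by (auto simp: odd_ge3_def) presburger

lemma odd_composites_subset_odd_ge3: "odd_composites \<subseteq> odd_ge3"
proof
  fix c :: int
  assume "c \<in> odd_composites"
  then have "odd c" "c > 1"
    by (auto simp: odd_composites_def)
  then show "c \<in> odd_ge3"
    unfolding odd_ge3_def mem_Collect_eq by presburger
qed

text \<open>Divisors of an odd number are odd, so \<open>2\<close> never occurs in the prime
  factorization. Listing it by primes serves the factorization condition, since primes survive the
  removal of composites.\<close>

lemma odd_ge3_prime_factor_list: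
  assumes "b \<in> odd_ge3"
  obtains cs where "cs \<noteq> []" "\<And>c. c \<in> set cs \<Longrightarrow> prime c \<and> c \<in> odd_ge3" "b = prod_list cs"
proof -
  have b: "odd b" "b \<ge> 3"
    using assms by (auto simp: odd_ge3_def)
  obtain cs where cs: "mset cs = prime_factorization b"
    using ex_mset by blast
  \<comment> \<open>The prime factors multiply to \<open>normalize b\<close>, which is
    \<open>b\<close> because \<open>b\<close> is positive.\<close>
  have prod: "prod_list cs = b"
  proof -
    have "prod_list cs = prod_mset (prime_factorization b)"
      using cs by (metis prod_mset_prod_list)
    then show ?thesis
      using b by (simp add: prod_mset_prime_factorization)
  qed
  have "prime c \<and> c \<in> odd_ge3" if "c \<in> set cs" for c
  proof -
    have "c \<in> prime_factors b"
      using that cs by (metis set_mset_mset)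
    then have "prime c" "c dvd b"
      by (auto simp: prime_factors_dvd)
    moreover have "odd c"
      using \<open>c dvd b\<close> b dvd_trans by blast
    ultimately show ?thesis
      using odd_prime_in_odd_ge3 by blast
  qed
  \<comment> \<open>An empty product would give \<open>b = 1\<close>.\<close>
  moreover have "cs \<noteq> []"
    using prod b by auto
  ultimately show ?thesis
    using that prod by blast
qed

lemma finite_primes_le: "finite {p :: int. prime p \<and> p \<le> x}"
  by (rule finite_subset[of _ "{0..x}"]) (auto simp: prime_ge_0_int)

lemma even_sum_avoiding:
  fixes r :: nat and k :: "nat \<Rightarrow> int"
  assumes comp: "\<And>i. i \<in> {1..r} \<Longrightarrow> k i \<in> odd_composites"
    and many: "\<And>i. i \<in> {1..r} \<Longrightarrow> prime_pi (k i) \<ge> i + 2"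
    and n: "even n" "n \<ge> 6"
  shows "n \<in> (odd_ge3 - k ` {1..r}) + (odd_ge3 - k ` {1..r})"
proof -
  let ?K = "k ` {1..r}"
  have prime_notin: "p \<notin> ?K" if "prime p" for p
    using comp that by (auto simp: odd_composites_def)
  have "\<exists>p. prime p \<and> odd p \<and> p \<le> n - 3 \<and> n - p \<notin> ?K"
  proof (cases "\<exists>j\<in>{1..r}. k j \<le> n - 3")
    case False
    then have "n - 3 \<notin> ?K"
      by auto
    moreover have "prime (3::int)"
      by simp
    ultimately show ?thesis
      using n by (intro exI[of _ 3]) auto
  next
    case True
    define J where "J = {j \<in> {1..r}. k j \<le> n - 3}"
    \<comment> \<open>Taking the largest index puts every removed number up to \<open>n - 3\<close>
      among \<open>k 1\<close>, ..., \<open>k i\<close>.\<close>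
    define i where "i = Max J"
    have J: "finite J" "J \<noteq> {}"
      using True by (auto simp: J_def)
    then have i: "i \<in> {1..r}" "k i \<le> n - 3"
      using Max_in[OF J] by (auto simp: J_def i_def)
    have i_max: "j \<le> i" if "j \<in> {1..r}" "k j \<le> n - 3" for j
      using that J by (auto simp: J_def i_def)
    \<comment> \<open>The bound \<open>i + 2\<close> counts the prime \<open>2\<close>; without it
      \<open>i + 1\<close> odd primes are left, one more than the indices up to
      \<open>i\<close>.\<close>
    define P where "P = {p :: int. prime p \<and> p \<le> k i} - {2}"
    have "card P \<ge> i + 1"
      using many[OF i(1)] finite_primes_le[of "k i"]
      by (auto simp: P_def prime_pi_def card_Diff_singleton_if)
    moreover have "card ((\<lambda>p. n - p) ` P) = card P"
      by (intro card_image inj_onI) auto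
    moreover have "card (k ` {1..i}) \<le> i"
      using card_image_le[of "{1..i}" k] by simp
    \<comment> \<open>Pigeonhole: at least \<open>i + 1\<close> distinct differences do not fit into
      at most \<open>i\<close> values.\<close>
    ultimately have "\<not> (\<lambda>p. n - p) ` P \<subseteq> k ` {1..i}"
      using card_mono[of "k ` {1..i}" "(\<lambda>p. n - p) ` P"] by auto
    then obtain p where p: "p \<in> P" "n - p \<notin> k ` {1..i}"
      by blast
    have "prime p" "odd p" "p \<le> n - 3"
      using p(1) i(2) prime_odd_int[of p] prime_ge_2_int[of p] by (auto simp: P_def)
    moreover have "n - p \<notin> ?K"
    proof
      assume "n - p \<in> ?K"
      then obtain j where j: "j \<in> {1..r}" "n - p = k j"
        by blast
      \<comment> \<open>This gives \<open>n - p \<le> n - 3\<close>, so a removed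
        \<open>n - p\<close> would have index at most \<open>i\<close>, against the choice of
        \<open>p\<close>.\<close>
      have "p \<ge> 3"
        using odd_prime_in_odd_ge3 \<open>prime p\<close> \<open>odd p\<close> by (auto simp: odd_ge3_def)
      then have "j \<le> i"
        using i_max j by simp
      then show False
        using p(2) j by auto
    qed
    ultimately show ?thesis
      by blast
  qed
  then obtain p where p: "prime p" "odd p" "p \<le> n - 3" "n - p \<notin> ?K"
    by blast
  have "p \<in> odd_ge3 - ?K"
    using p prime_notin odd_prime_in_odd_ge3 by blast
  \<comment> \<open>The parity comes from \<open>n\<close> even and \<open>p\<close> odd, the lower
    bound from \<open>p \<le> n - 3\<close>.\<close>
  moreover have "n - p \<in> odd_ge3 - ?K"
    using p n by (auto simp: odd_ge3_def)
  ultimately have "p + (n - p) \<in> (odd_ge3 - ?K) + (odd_ge3 - ?K)"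
    by (rule set_plus_intro)
  then show ?thesis
    by simp
qed

theorem theorem3p8:
  fixes r :: nat and k :: "nat \<Rightarrow> int"
  assumes "r \<ge> 3"
    and "\<And>i. i \<in> {1..r} \<Longrightarrow> k i \<in> odd_composites"
    and "strict_mono_on {1..r} k"
    and "\<And>i. i \<in> {1..r} \<Longrightarrow> prime_pi (k i) \<ge> i + 2"
  shows "odd_ge3 + odd_ge3 = (odd_ge3 - k ` {1..r}) + (odd_ge3 - k ` {1..r})
    \<and> sum_factor_collapsed_2 (k ` {1..r}) odd_ge3"
proof -
  let ?K = "k ` {1..r}"
  have sub: "?K \<subseteq> odd_ge3"
    using assms(2) odd_composites_subset_odd_ge3 by blast
  have prime_notin: "p \<notin> ?K" if "prime p" for p
    using assms(2) that by (auto simp: odd_composites_def)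
  have "odd_ge3 + odd_ge3 \<subseteq> (odd_ge3 - ?K) + (odd_ge3 - ?K)"
  proof
    fix n :: int
    assume "n \<in> odd_ge3 + odd_ge3"
    then have "even n" "n \<ge> 6"
      by (auto simp: odd_ge3_def elim!: set_plus_elim)
    then show "n \<in> (odd_ge3 - ?K) + (odd_ge3 - ?K)"
      using even_sum_avoiding assms(2,4) by blast
  qed
  moreover have "(odd_ge3 - ?K) + (odd_ge3 - ?K) \<subseteq> odd_ge3 + odd_ge3"
    by (intro set_plus_mono2) auto
  ultimately have sums: "odd_ge3 + odd_ge3 = (odd_ge3 - ?K) + (odd_ge3 - ?K)"
    by blast
  have "prime (3::int)"
    by simp
  \<comment> \<open>The witness \<open>3\<close> shows that both \<open>odd_ge3\<close> and
    \<open>odd_ge3 - ?K\<close> are non-empty.\<close>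
  then have three: "3 \<in> odd_ge3 - ?K"
    using prime_notin odd_prime_in_odd_ge3[of 3] by auto
  have "\<exists>cs. cs \<noteq> [] \<and> set cs \<subseteq> odd_ge3 - ?K \<and> b = prod_list cs"
    if b: "b \<in> odd_ge3" for b
  proof -
    obtain cs where cs: "cs \<noteq> []" "b = prod_list cs"
      and "\<And>c. c \<in> set cs \<Longrightarrow> prime c \<and> c \<in> odd_ge3"
      using odd_ge3_prime_factor_list[OF b] by blast
    then have "set cs \<subseteq> odd_ge3 - ?K"
      using prime_notin by blast
    with cs show ?thesis
      by blast
  qed
  then have "sum_factor_collapsed_2 ?K odd_ge3"
    unfolding sum_factor_collapsed_2_def using sub three sums by blast
  with sums show ?thesis
    by blast
qed

end
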